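(* Fix $d\in\{1,2,3,7,11\}$ and let $x\in\mathbb{Q}(\sqrt{-d})$. Then elements $R_1,\ldots,R_n$ with $R_n=x$ are the consecutive convergents of some complex continued fraction expansion of $x$ with partial quotients in $\mathbb{Z}[\omega_d]$ (i.e. there are $a_0,\ldots,a_{n-1}\in\mathbb{Z}[\omega_d]$ with $R_k=[a_0;a_1,\ldots,a_{k-1}]$ for $k=1,\ldots,n$) if and only if $\infty\to R_1\to\cdots\to R_n$ is a walk in $\mathcal{E}_d$ from $\infty$ to $x$.
   Context: $\omega_d=\sqrt{-d}$ for $d\in\{1,2\}$, $\omega_d=\frac{1+\sqrt{-d}}2$ for $d\in\{3,7,11\}$. $[a_0;a_1,\ldots,a_m]=a_0+\cfrac{1}{a_1+\cfrac{1}{\ddots+\cfrac1{a_m}}}$; its convergents are $[a_0;a_1,\ldots,a_k]$, $0\le k\le m$. The Farey graph $\mathcal{E}_d$ has vertex set $\mathbb{Q}(\sqrt{-d})\cup\{\infty\}$ and edges $A(\infty)\to A(0)$ for $A\in\mathrm{PSL}(2,\mathbb{Z}[\omega_d])$ acting by Möbius transformations. A walk is a sequence of consecutive edges. *)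

theory Defs
  imports "HOL-Analysis.Analysis" "Graph_Theory.Graph_Theory"
begin

definition sqrt_neg :: "nat \<Rightarrow> complex" where
  "sqrt_neg d = csqrt (- of_nat d)"

(* Meaningful for d in {1,2,3,7,11} only. *)
definition omega :: "nat \<Rightarrow> complex" where
  "omega d = (if d \<in> {1, 2} then sqrt_neg d else (1 + sqrt_neg d) / 2)"

definition Z_omega :: "nat \<Rightarrow> complex set" where
  "Z_omega d = {of_int a + of_int b * omega d | a b. True}"

definition Q_sqrt_neg :: "nat \<Rightarrow> complex set" where
  "Q_sqrt_neg d = {of_rat a + of_rat b * sqrt_neg d | a b. True}"

datatype csphere = Fin complex | Infty

fun csphere_inverse :: "csphere \<Rightarrow> csphere" where
  "csphere_inverse (Fin z) = (if z = 0 then Infty else Fin (1 / z))"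
| "csphere_inverse Infty = Fin 0"

fun csphere_translate :: "complex \<Rightarrow> csphere \<Rightarrow> csphere" where
  "csphere_translate a (Fin z) = Fin (a + z)"
| "csphere_translate a Infty = Infty"

(* [a_0; a_1, ..., a_m], evaluated in the Riemann sphere so that a vanishing denominator
   gives the point at infinity. The empty list is not a continued fraction. *)
fun cfrac_eval :: "complex list \<Rightarrow> csphere" where
  "cfrac_eval [] = undefined"
| "cfrac_eval [a] = Fin a"
| "cfrac_eval (a # b # as) = csphere_translate a (csphere_inverse (cfrac_eval (b # as)))"

definition cfrac_convergent :: "(nat \<Rightarrow> complex) \<Rightarrow> nat \<Rightarrow> csphere" where
  "cfrac_convergent a k = cfrac_eval (map a [0..<Suc k])"

fun moebius :: "complex^2^2 \<Rightarrow> csphere \<Rightarrow> csphere" where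
  "moebius A (Fin z) =
     (if A$2$1 * z + A$2$2 = 0 then Infty
      else Fin ((A$1$1 * z + A$1$2) / (A$2$1 * z + A$2$2)))"
| "moebius A Infty = (if A$2$1 = 0 then Infty else Fin (A$1$1 / A$2$1))"

definition SL2 :: "complex set \<Rightarrow> (complex^2^2) set" where
  "SL2 S = {A. (\<forall>i j. A$i$j \<in> S) \<and> det A = 1}"

(* The elements are the classes {A, -A} with A in SL(2,S). *)
definition PSL2 :: "complex set \<Rightarrow> (complex^2^2) set set" where
  "PSL2 S = SL2 S // {(A, B). A \<in> SL2 S \<and> B \<in> SL2 S \<and> (B = A \<or> B = - A)}"

definition psl_apply :: "(complex^2^2) set \<Rightarrow> csphere \<Rightarrow> csphere" where
  "psl_apply C z = the_elem ((\<lambda>A. moebius A z) ` C)"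

lemma moebius_uminus: "moebius (- A) z = moebius A z"
proof (cases z)
  case (Fin w)
  have "(- A)$2$1 * w + (- A)$2$2 = - (A$2$1 * w + A$2$2)"
    "(- A)$1$1 * w + (- A)$1$2 = - (A$1$1 * w + A$1$2)"
    by simp_all
  then show ?thesis
    unfolding Fin moebius.simps by (simp only: minus_divide_divide neg_equal_0_iff_equal)
qed simp

lemma psl_apply_eq:
  assumes "C \<in> PSL2 S" "A \<in> C"
  shows "psl_apply C z = moebius A z"
proof -
  obtain B where "C = {(A, B). A \<in> SL2 S \<and> B \<in> SL2 S \<and> (B = A \<or> B = - A)} `` {B}"
    using assms(1) unfolding PSL2_def quotient_def by blast
  then have "moebius A' z = moebius A z" if "A' \<in> C" for A'
    using assms(2) that by (auto simp: moebius_uminus)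
  then have "(\<lambda>A. moebius A z) ` C = {moebius A z}"
    using assms(2) by blast
  then show ?thesis
    by (simp add: psl_apply_def)
qed

definition farey_graph :: "nat \<Rightarrow> csphere pair_pre_digraph" where
  "farey_graph d =
     \<lparr> pverts = insert Infty (Fin ` Q_sqrt_neg d),
       parcs = {(psl_apply C Infty, psl_apply C (Fin 0)) | C. C \<in> PSL2 (Z_omega d)} \<rparr>"

end

theory Submission
  imports Defs
begin

text \<open>
  Write a continued fraction as the image of infinity under the product of the matrices
  with rows \<open>(a, 1)\<close> and \<open>(1, 0)\<close>. These products have determinant 1 or -1, and changing the
  sign of a column does not change the images of infinity and 0, so edges may be described by
  matrices of determinant 1 or -1. If \<open>M\<close> is such a product, then \<open>M(a)\<close> with \<open>a\<close> in
  the ring runs over exactly the neighbours of \<open>M(\<infinity>)\<close>, because the neighbours of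
  infinity are exactly the elements of the ring.
\<close>

section \<open>Two-by-two matrices and Moebius maps in homogeneous coordinates\<close>

definition mat22 :: "complex \<Rightarrow> complex \<Rightarrow> complex \<Rightarrow> complex \<Rightarrow> complex^2^2" where
  "mat22 a b c e = (\<chi> i j. if i = 1 then (if j = 1 then a else b) else (if j = 1 then c else e))"

lemma mat22_nth [simp]:
  "mat22 a b c e $ 1 $ 1 = a" "mat22 a b c e $ 1 $ 2 = b"
  "mat22 a b c e $ 2 $ 1 = c" "mat22 a b c e $ 2 $ 2 = e"
  by (simp_all add: mat22_def)

lemma det_mat22 [simp]: "det (mat22 a b c e) = a * e - b * c"
  by (simp add: det_2)

lemma matrix_mult_22_nth:
  fixes A B :: "complex^2^2"
  shows "(A ** B) $ i $ j = A $ i $ 1 * B $ 1 $ j + A $ i $ 2 * B $ 2 $ j"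
  by (simp add: matrix_matrix_mult_def sum_2)

text \<open>The point of the Riemann sphere with homogeneous coordinates \<open>(p : q)\<close>. The
  pair \<open>(0, 0)\<close> also yields \<open>Infty\<close>, so it has to be excluded where the
  coordinates matter.\<close>

definition fraction :: "complex \<Rightarrow> complex \<Rightarrow> csphere" where
  "fraction p q = (if q = 0 then Infty else Fin (p / q))"

lemma fraction_cancel: "t \<noteq> 0 \<Longrightarrow> fraction (t * p) (t * q) = fraction p q"
  by (simp add: fraction_def)

lemma moebius_fraction:
  assumes "det A \<noteq> 0" "p \<noteq> 0 \<or> q \<noteq> 0"
  shows "moebius A (fraction p q) = fraction (A$1$1 * p + A$1$2 * q) (A$2$1 * p + A$2$2 * q)"
proof (cases "q = 0")
  case True
  then show ?thesis using assms by (simp add: fraction_def)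
next
  case False
  have *: "A$1$1 * p + A$1$2 * q = q * (A$1$1 * (p / q) + A$1$2)"
    "A$2$1 * p + A$2$2 * q = q * (A$2$1 * (p / q) + A$2$2)"
    using False by (simp_all add: field_simps)
  have "moebius A (fraction p q) = fraction (A$1$1 * (p / q) + A$1$2) (A$2$1 * (p / q) + A$2$2)"
    using False by (simp add: fraction_def)
  then show ?thesis
    unfolding * using False by (simp only: fraction_cancel not_False_eq_True)
qed

lemma csphere_fraction_cases:
  obtains p q where "z = fraction p q" "p \<noteq> 0 \<or> q \<noteq> 0"
proof (cases z)
  case (Fin w)
  then show ?thesis using that[of w 1] by (simp add: fraction_def)
next
  case Infty
  then show ?thesis using that[of 1 0] by (simp add: fraction_def)
qed

text \<open>In homogeneous coordinates both sides are linear, so composition is the matrix product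
  and no case distinction on poles is left.\<close>

lemma moebius_mult:
  assumes "det A \<noteq> 0" "det B \<noteq> 0"
  shows "moebius (A ** B) z = moebius A (moebius B z)"
proof -
  obtain p q where z: "z = fraction p q" and pq: "p \<noteq> 0 \<or> q \<noteq> 0"
    by (rule csphere_fraction_cases)
  define r s where "r = B$1$1 * p + B$1$2 * q" and "s = B$2$1 * p + B$2$2 * q"
  \<comment> \<open>The adjugate of \<open>B\<close> recovers \<open>(p, q)\<close> from
    \<open>(r, s)\<close> up to the factor \<open>det B\<close>, so \<open>(r, s)\<close> cannot be
    \<open>(0, 0)\<close>.\<close>
  have "det B * p = B$2$2 * r - B$1$2 * s" "det B * q = B$1$1 * s - B$2$1 * r"
    by (simp_all add: r_def s_def det_2 algebra_simps)
  then have rs: "r \<noteq> 0 \<or> s \<noteq> 0"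
    using pq assms(2) by auto
  have AB: "det (A ** B) \<noteq> 0"
    using assms by (simp add: det_mul)
  show ?thesis
    unfolding z moebius_fraction[OF AB pq] moebius_fraction[OF assms(2) pq]
    unfolding r_def[symmetric] s_def[symmetric] moebius_fraction[OF assms(1) rs]
    by (simp add: matrix_mult_22_nth r_def s_def algebra_simps)
qed

lemma mat_1_22_nth [simp]:
  "(mat 1 :: complex^2^2) $ 1 $ 1 = 1" "(mat 1 :: complex^2^2) $ 1 $ 2 = 0"
  "(mat 1 :: complex^2^2) $ 2 $ 1 = 0" "(mat 1 :: complex^2^2) $ 2 $ 2 = 1"
  by (simp_all add: mat_def)

section \<open>Continued fractions as matrix products\<close>

definition cf_matrix :: "complex list \<Rightarrow> complex^2^2" where
  "cf_matrix as = foldr (\<lambda>a M. mat22 a 1 1 0 ** M) as (mat 1)"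

lemma cf_matrix_Nil [simp]: "cf_matrix [] = mat 1"
  and cf_matrix_Cons [simp]: "cf_matrix (a # as) = mat22 a 1 1 0 ** cf_matrix as"
  by (simp_all add: cf_matrix_def)

lemma cf_matrix_append: "cf_matrix (as @ bs) = cf_matrix as ** cf_matrix bs"
  by (induction as) (simp_all add: matrix_mul_assoc)

lemma det_cf_matrix: "det (cf_matrix as) = (- 1) ^ length as"
  by (induction as) (simp_all add: det_mul)

lemma moebius_cf_matrix_step:
  "moebius (mat22 a 1 1 0) z = csphere_translate a (csphere_inverse z)"
  by (cases z) (simp_all add: field_simps)

text \<open>Each factor \<open>mat22 a 1 1 0\<close> acts as \<open>a + 1/z\<close>, and the
  innermost one sends infinity to the last quotient. The empty list is excluded because
  \<open>cfrac_eval []\<close> is unspecified, whereas the empty product gives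
  \<open>Infty\<close>.\<close>

lemma cfrac_eval_eq_moebius:
  "as \<noteq> [] \<Longrightarrow> cfrac_eval as = moebius (cf_matrix as) Infty"
proof (induction as rule: cfrac_eval.induct)
  case (3 a b as)
  have "moebius (cf_matrix (a # b # as)) Infty
      = moebius (mat22 a 1 1 0) (moebius (cf_matrix (b # as)) Infty)"
    unfolding cf_matrix_Cons[of a] by (rule moebius_mult) (simp_all add: det_cf_matrix det_mul)
  then show ?case using 3 by (simp add: moebius_cf_matrix_step)
qed simp_all

text \<open>Appending a quotient passes from \<open>M(Infty)\<close> to \<open>M(b)\<close> with the
  same matrix \<open>M\<close>; this links convergents to edges.\<close>

lemma moebius_cf_matrix_snoc:
  "moebius (cf_matrix (as @ [b])) Infty = moebius (cf_matrix as) (Fin b)"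
  by (simp add: cf_matrix_append matrix_mult_22_nth)

section \<open>Unimodular matrices and Farey edges over an arbitrary subring containing 1\<close>

locale complex_subring =
  fixes S :: "complex set"
  assumes one_closed: "1 \<in> S"
    and diff_closed: "x \<in> S \<Longrightarrow> y \<in> S \<Longrightarrow> x - y \<in> S"
    and mult_closed: "x \<in> S \<Longrightarrow> y \<in> S \<Longrightarrow> x * y \<in> S"
begin

lemma zero_closed: "0 \<in> S"
  using diff_closed[OF one_closed one_closed] by simp

lemma uminus_closed: "x \<in> S \<Longrightarrow> - x \<in> S"
  using diff_closed[OF zero_closed] by simp

lemma add_closed: "x \<in> S \<Longrightarrow> y \<in> S \<Longrightarrow> x + y \<in> S"
  using diff_closed[of x "- y"] uminus_closed by simp

lemmas closed = zero_closed one_closed uminus_closed diff_closed add_closed mult_closed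

definition unimodular :: "(complex^2^2) set" where
  "unimodular = {A. (\<forall>i j. A$i$j \<in> S) \<and> det A \<in> {1, - 1}}"

lemma unimodular_nth: "A \<in> unimodular \<Longrightarrow> A$i$j \<in> S"
  by (simp add: unimodular_def)

lemma unimodular_det: "A \<in> unimodular \<Longrightarrow> det A = 1 \<or> det A = - 1"
  by (simp add: unimodular_def)

lemma unimodular_det_nonzero: "A \<in> unimodular \<Longrightarrow> det A \<noteq> 0"
  by (auto simp: unimodular_def)

lemma mat22_unimodular:
  "{a, b, c, e} \<subseteq> S \<Longrightarrow> a * e - b * c \<in> {1, - 1} \<Longrightarrow> mat22 a b c e \<in> unimodular"
  by (simp add: unimodular_def forall_2)

lemma unimodular_mult: "A \<in> unimodular \<Longrightarrow> B \<in> unimodular \<Longrightarrow> A ** B \<in> unimodular"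
  by (auto simp: unimodular_def det_mul matrix_mult_22_nth intro!: closed)

text \<open>The determinant is 1 or -1 and hence its own inverse, so \<open>det A\<close> times the
  adjugate is an inverse with entries in \<open>S\<close>.\<close>

lemma unimodular_inverse:
  assumes "A \<in> unimodular"
  obtains B where "B \<in> unimodular" "A ** B = mat 1"
proof
  let ?B = "mat22 (det A * A$2$2) (- det A * A$1$2) (- det A * A$2$1) (det A * A$1$1)"
  have "det A \<in> S"
    using unimodular_det[OF assms] closed by auto
  moreover have det: "det A * det A = 1"
    using unimodular_det[OF assms] by auto
  have "det ?B = det A * det A * det A"
    unfolding det_mat22 by (simp add: det_2[of A] algebra_simps)
  then have "det ?B \<in> {1, - 1}"
    using unimodular_det[OF assms] by auto
  ultimately show "?B \<in> unimodular"
    using unimodular_nth[OF assms]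
    by (intro mat22_unimodular) (auto intro!: closed)
  have "(A ** ?B) $ i $ j = det A * det A * (mat 1 $ i $ j)" for i j
    by (cases i rule: exhaust_2[THEN disjE]; cases j rule: exhaust_2[THEN disjE])
      (simp_all add: matrix_mult_22_nth det_2[of A] mat_def algebra_simps)
  then show "A ** ?B = mat 1"
    by (simp add: vec_eq_iff det)
qed

lemma cf_matrix_unimodular: "set as \<subseteq> S \<Longrightarrow> cf_matrix as \<in> unimodular"
proof (induction as)
  case Nil
  then show ?case by (simp add: unimodular_def forall_2 mat_def closed det_2)
next
  case (Cons a as)
  then show ?case by (auto intro!: unimodular_mult mat22_unimodular closed)
qed

definition farey_edge :: "csphere \<Rightarrow> csphere \<Rightarrow> bool" where
  "farey_edge z w \<longleftrightarrow> (\<exists>A\<in>unimodular. z = moebius A Infty \<and> w = moebius A (Fin 0))"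

text \<open>Applying the inverse of \<open>M\<close> reduces the claim to the neighbours of
  infinity. A unimodular matrix fixing infinity is upper triangular with units on the diagonal, so
  it sends 0 into \<open>S\<close>; conversely, translations by elements of \<open>S\<close> reach
  all of \<open>S\<close>.\<close>

lemma farey_edge_moebius_Infty_iff:
  assumes M: "M \<in> unimodular"
  shows "farey_edge (moebius M Infty) w \<longleftrightarrow> (\<exists>a\<in>S. w = moebius M (Fin a))"
proof
  assume "farey_edge (moebius M Infty) w"
  then obtain A where A: "A \<in> unimodular" "moebius M Infty = moebius A Infty"
      "w = moebius A (Fin 0)"
    unfolding farey_edge_def by blast
  obtain N where N: "N \<in> unimodular" "M ** N = mat 1"
    using unimodular_inverse[OF M] .
  then have NM: "N ** M = mat 1"
    using matrix_left_right_inverse by blast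
  define B where "B = N ** A"
  have B: "B \<in> unimodular"
    unfolding B_def by (intro unimodular_mult N A)
  have "moebius B Infty = moebius N (moebius M Infty)"
    using A N by (simp add: B_def moebius_mult unimodular_det_nonzero del: moebius.simps)
  also have "\<dots> = moebius (N ** M) Infty"
    using M N by (simp add: moebius_mult unimodular_det_nonzero del: moebius.simps)
  finally have B21: "B$2$1 = 0"
    by (simp add: NM split: if_splits)
  then have det: "det B = B$1$1 * B$2$2"
    by (simp add: det_2)
  then have "B$2$2 \<noteq> 0"
    using unimodular_det_nonzero[OF B] by auto
  then have "moebius B (Fin 0) = Fin (B$1$2 / B$2$2)"
    by simp
  \<comment> \<open>Since \<open>B$1$1 * B$2$2 = det B\<close> squares to 1, the inverse of
    \<open>B$2$2\<close> is \<open>det B * B$1$1\<close>; this form shows that the quotient lies in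
    \<open>S\<close>.\<close>
  moreover have "B$1$2 / B$2$2 = det B * (B$1$1 * B$1$2)"
  proof -
    have "det B * (B$1$1 * B$1$2) * B$2$2 = det B * det B * B$1$2"
      by (simp add: det)
    also have "\<dots> = B$1$2"
      using unimodular_det[OF B] by auto
    finally show ?thesis
      using \<open>B$2$2 \<noteq> 0\<close> by (simp add: divide_eq_eq)
  qed
  moreover have "det B * (B$1$1 * B$1$2) \<in> S"
    using unimodular_det[OF B] by (auto intro!: closed unimodular_nth B)
  moreover have "M ** B = A"
    by (simp add: B_def matrix_mul_assoc N)
  then have "w = moebius M (moebius B (Fin 0))"
    using A M B by (metis moebius_mult unimodular_det_nonzero)
  ultimately show "\<exists>a\<in>S. w = moebius M (Fin a)"
    by auto
next
  assume "\<exists>a\<in>S. w = moebius M (Fin a)"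
  then obtain a where a: "a \<in> S" "w = moebius M (Fin a)"
    by blast
  \<comment> \<open>Translation by \<open>a\<close> fixes infinity and sends 0 to \<open>a\<close>,
    so \<open>M ** ?U\<close> witnesses the edge.\<close>
  let ?U = "mat22 1 a 0 1"
  have U: "?U \<in> unimodular"
    using a by (auto intro!: mat22_unimodular closed)
  have "moebius (M ** ?U) Infty = moebius M Infty" "moebius (M ** ?U) (Fin 0) = w"
    by (simp_all add: a matrix_mult_22_nth)
  then show "farey_edge (moebius M Infty) w"
    unfolding farey_edge_def using unimodular_mult[OF M U] by metis
qed

text \<open>Induction on the number of edges: once \<open>X n\<close> is \<open>M(Infty)\<close> for
  the product \<open>M\<close> of the quotients found so far, the next edge amounts to a choice of
  one more quotient. Here \<open>X k\<close> uses the first \<open>k\<close> quotients, so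
  \<open>X 0\<close> is the empty product applied to infinity.\<close>

lemma farey_path_iff_convergents:
  assumes "X 0 = Infty"
  shows "(\<forall>i<n. farey_edge (X i) (X (Suc i))) \<longleftrightarrow>
    (\<exists>a. (\<forall>i<n. a i \<in> S) \<and> (\<forall>k\<le>n. X k = moebius (cf_matrix (map a [0..<k])) Infty))"
proof (induction n)
  case 0
  then show ?case using assms by simp
next
  case (Suc n)
  have step: "farey_edge (moebius (cf_matrix (map a [0..<n])) Infty) w \<longleftrightarrow>
      (\<exists>b\<in>S. w = moebius (cf_matrix (map a [0..<n] @ [b])) Infty)"
    if "\<forall>i<n. a i \<in> S" for a w
  proof -
    have "cf_matrix (map a [0..<n]) \<in> unimodular"
      using that by (intro cf_matrix_unimodular) auto
    from farey_edge_moebius_Infty_iff[OF this] show ?thesis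
      by (simp only: moebius_cf_matrix_snoc)
  qed
  show ?case
  proof
    assume *: "\<forall>i<Suc n. farey_edge (X i) (X (Suc i))"
    then obtain a where a: "\<forall>i<n. a i \<in> S"
        "\<forall>k\<le>n. X k = moebius (cf_matrix (map a [0..<k])) Infty"
      using Suc by auto
    have "farey_edge (moebius (cf_matrix (map a [0..<n])) Infty) (X (Suc n))"
      using * a(2) by (metis lessI order_refl)
    then obtain b where b: "b \<in> S" "X (Suc n) = moebius (cf_matrix (map a [0..<n] @ [b])) Infty"
      using step[OF a(1)] by blast
    \<comment> \<open>Setting the quotient with index \<open>n\<close> leaves all earlier
      convergents unchanged.\<close>
    have upd: "map (a(n := b)) [0..<k] = map a [0..<k]" if "k \<le> n" for k
      using that by auto
    show "\<exists>a. (\<forall>i<Suc n. a i \<in> S) \<and>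
        (\<forall>k\<le>Suc n. X k = moebius (cf_matrix (map a [0..<k])) Infty)"
    proof (intro exI[of _ "a(n := b)"] conjI allI impI)
      fix k assume "k \<le> Suc n"
      then consider "k \<le> n" | "k = Suc n" by linarith
      then show "X k = moebius (cf_matrix (map (a(n := b)) [0..<k])) Infty"
      proof cases
        case 1
        then show ?thesis using a(2) upd by presburger
      next
        case 2
        have "map (a(n := b)) [0..<Suc n] = map a [0..<n] @ [b]"
          using upd[of n] by simp
        then show ?thesis using 2 b(2) by presburger
      qed
    qed (use a(1) b(1) in \<open>auto simp: less_Suc_eq\<close>)
  next
    assume "\<exists>a. (\<forall>i<Suc n. a i \<in> S) \<and>
        (\<forall>k\<le>Suc n. X k = moebius (cf_matrix (map a [0..<k])) Infty)"
    then obtain a where a: "\<forall>i<Suc n. a i \<in> S"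
        "\<And>k. k \<le> Suc n \<Longrightarrow> X k = moebius (cf_matrix (map a [0..<k])) Infty"
      by blast
    then have "\<forall>i<n. farey_edge (X i) (X (Suc i))"
      using Suc by (meson le_Suc_eq less_Suc_eq)
    moreover have "farey_edge (X n) (X (Suc n))"
    proof -
      have "X (Suc n) = moebius (cf_matrix (map a [0..<n] @ [a n])) Infty"
        using a(2)[of "Suc n"] by simp
      then show ?thesis
        using step[of a "X (Suc n)"] a(1) a(2)[of n] by auto
    qed
    ultimately show "\<forall>i<Suc n. farey_edge (X i) (X (Suc i))"
      by (auto simp: less_Suc_eq)
  qed
qed

section \<open>Comparison with the edges given by \<open>PSL2\<close>\<close>

lemma psl_edge_iff_farey_edge:
  "(z, w) \<in> {(psl_apply C Infty, psl_apply C (Fin 0)) | C. C \<in> PSL2 S} \<longleftrightarrow> farey_edge z w"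
proof
  assume "(z, w) \<in> {(psl_apply C Infty, psl_apply C (Fin 0)) | C. C \<in> PSL2 S}"
  then obtain C where C: "C \<in> PSL2 S" "z = psl_apply C Infty" "w = psl_apply C (Fin 0)"
    by blast
  then obtain A where A: "A \<in> SL2 S" "A \<in> C"
    unfolding PSL2_def quotient_def by auto
  then have "A \<in> unimodular"
    by (simp add: SL2_def unimodular_def)
  then show "farey_edge z w"
    unfolding farey_edge_def using C psl_apply_eq[OF C(1) A(2)] by auto
next
  assume "farey_edge z w"
  then obtain A where A: "A \<in> unimodular" "z = moebius A Infty" "w = moebius A (Fin 0)"
    unfolding farey_edge_def by blast
  \<comment> \<open>Right multiplication by \<open>?D\<close> scales the second column by
    \<open>det A\<close>. The determinant becomes \<open>det A * det A = 1\<close>, while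
    \<open>?D\<close> fixes both infinity and 0.\<close>
  let ?D = "mat22 1 0 0 (det A)"
  have det: "det A \<in> S" "det A * det A = 1"
    using unimodular_det[OF A(1)] closed by auto
  then have D: "?D \<in> unimodular"
    using unimodular_det[OF A(1)] by (intro mat22_unimodular) (auto intro: closed)
  define B where "B = A ** ?D"
  have "B \<in> unimodular"
    unfolding B_def by (intro unimodular_mult A D)
  then have B: "B \<in> SL2 S"
    by (simp add: SL2_def unimodular_def) (simp add: B_def det_mul det)
  define C where "C = {(A, B). A \<in> SL2 S \<and> B \<in> SL2 S \<and> (B = A \<or> B = - A)} `` {B}"
  have C: "C \<in> PSL2 S" "B \<in> C"
    unfolding C_def PSL2_def by (rule quotientI[OF B]) (simp add: B)
  have "moebius B v = moebius A (moebius ?D v)" for v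
    unfolding B_def by (intro moebius_mult unimodular_det_nonzero A D)
  moreover have "moebius ?D Infty = Infty" "moebius ?D (Fin 0) = Fin 0"
    using unimodular_det_nonzero[OF A(1)] by simp_all
  ultimately have "z = psl_apply C Infty" "w = psl_apply C (Fin 0)"
    unfolding A(2,3) psl_apply_eq[OF C] by (simp_all only:)
  then show "(z, w) \<in> {(psl_apply C Infty, psl_apply C (Fin 0)) | C. C \<in> PSL2 S}"
    using C(1) by blast
qed

end

section \<open>Arithmetic of \<open>Z_omega d\<close> and \<open>Q_sqrt_neg d\<close>\<close>

lemma sqrt_neg_square: "sqrt_neg d * sqrt_neg d = - of_nat d"
  unfolding sqrt_neg_def by (metis power2_csqrt power2_eq_square)

text \<open>\<open>omega d\<close> is a quadratic integer: its square is \<open>-d\<close> for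
  \<open>d\<close> in \<open>{1, 2}\<close> and \<open>omega d - (d + 1)/4\<close>
  otherwise.\<close>

lemma omega_square:
  assumes "d \<in> {1, 2, 3, 7, 11}"
  obtains s t :: int where "omega d * omega d = of_int s + of_int t * omega d"
proof (cases "d \<in> {1, 2}")
  case True
  then show ?thesis
    using that[of "- int d" 0] sqrt_neg_square[of d] by (simp add: omega_def)
next
  case False
  \<comment> \<open>The remaining values 3, 7, 11 are all 3 modulo 4, so this integer division is
    exact.\<close>
  have "of_nat d = 4 * of_int ((int d + 1) div 4) - (1 :: complex)"
    using assms False by auto
  then have sq: "sqrt_neg d * sqrt_neg d = 1 - 4 * of_int ((int d + 1) div 4)"
    by (simp add: sqrt_neg_square)
  have "omega d * omega d = (1 + 2 * sqrt_neg d + sqrt_neg d * sqrt_neg d) / 4"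
    using False by (simp add: omega_def field_simps)
  also have "\<dots> = of_int (- ((int d + 1) div 4)) + of_int 1 * omega d"
    unfolding sq using False by (simp add: omega_def field_simps)
  finally have "omega d * omega d = of_int (- ((int d + 1) div 4)) + of_int 1 * omega d" .
  then show ?thesis using that by blast
qed

lemma complex_subring_Z_omega:
  assumes "d \<in> {1, 2, 3, 7, 11}"
  shows "complex_subring (Z_omega d)"
proof
  show "1 \<in> Z_omega d"
    unfolding Z_omega_def by (intro CollectI exI[of _ 1] exI[of _ 0]) simp
next
  fix x y assume "x \<in> Z_omega d" "y \<in> Z_omega d"
  then obtain a b a' b' :: int where xy:
    "x = of_int a + of_int b * omega d" "y = of_int a' + of_int b' * omega d"
    unfolding Z_omega_def by blast
  have "x - y = of_int (a - a') + of_int (b - b') * omega d"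
    by (simp add: xy algebra_simps)
  then show "x - y \<in> Z_omega d"
    unfolding Z_omega_def by blast
  obtain s t :: int where w: "omega d * omega d = of_int s + of_int t * omega d"
    using omega_square[OF assms] .
  have "x * y = of_int a * of_int a' + (of_int a * of_int b' + of_int b * of_int a') * omega d
      + of_int b * of_int b' * (omega d * omega d)"
    by (simp add: xy algebra_simps)
  also have "\<dots> = of_int (a * a' + b * b' * s) + of_int (a * b' + b * a' + b * b' * t) * omega d"
    unfolding w by (simp add: algebra_simps)
  finally show "x * y \<in> Z_omega d"
    unfolding Z_omega_def by blast
qed

lemma Q_sqrt_neg_mult:
  assumes "x \<in> Q_sqrt_neg d" "y \<in> Q_sqrt_neg d"
  shows "x * y \<in> Q_sqrt_neg d"
proof -
  obtain a b a' b' :: rat where xy: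
    "x = of_rat a + of_rat b * sqrt_neg d" "y = of_rat a' + of_rat b' * sqrt_neg d"
    using assms unfolding Q_sqrt_neg_def by blast
  have "x * y = of_rat a * of_rat a' + (of_rat a * of_rat b' + of_rat b * of_rat a') * sqrt_neg d
      + of_rat b * of_rat b' * (sqrt_neg d * sqrt_neg d)"
    by (simp add: xy algebra_simps)
  also have "\<dots> = of_rat (a * a' - b * b' * of_nat d) + of_rat (a * b' + b * a') * sqrt_neg d"
    unfolding sqrt_neg_square by (simp add: of_rat_add of_rat_diff of_rat_mult)
  finally show ?thesis
    unfolding Q_sqrt_neg_def by blast
qed

lemma Q_sqrt_neg_inverse:
  assumes "x \<in> Q_sqrt_neg d"
  shows "inverse x \<in> Q_sqrt_neg d"
\<comment> \<open>For \<open>d = 0\<close> the set collapses to the rationals and the norm form used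
  below is degenerate; \<open>inverse 0\<close> is 0 by convention.\<close>
proof (cases "x = 0 \<or> d = 0")
  case True
  then show ?thesis
  proof
    assume "d = 0"
    then have "sqrt_neg d = 0" by (simp add: sqrt_neg_def)
    moreover obtain a :: rat where "x = of_rat a"
      using assms \<open>sqrt_neg d = 0\<close> unfolding Q_sqrt_neg_def by auto
    ultimately show ?thesis
      unfolding Q_sqrt_neg_def by (auto simp: of_rat_inverse[symmetric])
  qed (use assms in simp)
next
  case False
  obtain a b :: rat where x: "x = of_rat a + of_rat b * sqrt_neg d"
    using assms unfolding Q_sqrt_neg_def by blast
  \<comment> \<open>The norm of \<open>x\<close>, positive as soon as \<open>a\<close> or
    \<open>b\<close> is nonzero; the inverse is the conjugate divided by it.\<close>
  define N where "N = a * a + of_nat d * (b * b)"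
  have "a \<noteq> 0 \<or> b \<noteq> 0"
    using False x by auto
  then have "N \<noteq> 0"
    unfolding N_def using False
    by (metis add_nonneg_eq_0_iff mult_eq_0_iff of_nat_0_le_iff of_nat_eq_0_iff
        mult_nonneg_nonneg zero_le_square)
  have "x * (of_rat a - of_rat b * sqrt_neg d)
      = of_rat a * of_rat a - of_rat b * of_rat b * (sqrt_neg d * sqrt_neg d)"
    by (simp add: x algebra_simps)
  also have "\<dots> = of_rat N"
    unfolding sqrt_neg_square N_def by (simp add: of_rat_add of_rat_mult)
  finally have "inverse x = (of_rat a - of_rat b * sqrt_neg d) / of_rat N"
    using \<open>N \<noteq> 0\<close> False by (simp add: field_simps)
  also have "\<dots> = of_rat (a / N) + of_rat (- b / N) * sqrt_neg d"
    by (simp add: of_rat_divide of_rat_minus diff_divide_distrib)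
  finally show ?thesis
    unfolding Q_sqrt_neg_def by blast
qed

lemma Z_omega_subset_Q_sqrt_neg: "Z_omega d \<subseteq> Q_sqrt_neg d"
proof
  fix x assume "x \<in> Z_omega d"
  then obtain a b :: int where x: "x = of_int a + of_int b * omega d"
    unfolding Z_omega_def by blast
  \<comment> \<open>The alternatives correspond to the two branches of \<open>omega\<close>.\<close>
  have "x = of_rat (of_int a) + of_rat (of_int b) * sqrt_neg d \<or>
      x = of_rat (of_int a + of_int b / 2) + of_rat (of_int b / 2) * sqrt_neg d"
    unfolding x omega_def by (simp add: of_rat_add of_rat_divide add_divide_distrib distrib_left)
  then show "x \<in> Q_sqrt_neg d"
    unfolding Q_sqrt_neg_def by blast
qed

text \<open>A walk must also stay in the vertex set. Every vertex after the initial infinity is the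
  target of an edge, so targets are enough.\<close>

lemma farey_edge_target_in_verts:
  assumes "complex_subring (Z_omega d)" "complex_subring.farey_edge (Z_omega d) z w"
  shows "w \<in> insert Infty (Fin ` Q_sqrt_neg d)"
proof -
  interpret complex_subring "Z_omega d" by fact
  obtain A where A: "A \<in> unimodular" "w = moebius A (Fin 0)"
    using assms(2) unfolding farey_edge_def by blast
  have "A$i$j \<in> Q_sqrt_neg d" for i j
    using unimodular_nth[OF A(1)] Z_omega_subset_Q_sqrt_neg by blast
  then show ?thesis
    using A(2) by (auto simp: divide_inverse intro!: Q_sqrt_neg_mult Q_sqrt_neg_inverse)
qed

section \<open>Walks as sequences of Farey edges\<close>

lemma set_vwalk_arcs_map_upt:
  "set (vwalk_arcs (map X [m..<Suc (m + n)])) = (\<lambda>i. (X i, X (Suc i))) ` {m..<m + n}"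
proof (induction n arbitrary: m)
  case 0
  then show ?case by simp
next
  case (Suc n)
  have "vwalk_arcs (map X [m..<Suc (m + Suc n)])
      = (X m, X (Suc m)) # vwalk_arcs (map X [Suc m..<Suc (Suc m + n)])"
    by (simp add: upt_conv_Cons del: upt_Suc)
  moreover have "{m..<m + Suc n} = insert m {Suc m..<Suc m + n}"
    by auto
  ultimately show ?case
    using Suc.IH[of "Suc m"] by simp
qed

lemma vwalk_farey_graph_iff:
  assumes "d \<in> {1, 2, 3, 7, 11}" "X 0 = Infty"
  shows "vwalk (map X [0..<Suc n]) (with_proj (farey_graph d)) \<longleftrightarrow>
    (\<forall>i<n. complex_subring.farey_edge (Z_omega d) (X i) (X (Suc i)))"
proof -
  interpret complex_subring "Z_omega d"
    using complex_subring_Z_omega[OF assms(1)] .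
  have "(z, w) \<in> arcs_ends (with_proj (farey_graph d)) \<longleftrightarrow> farey_edge z w" for z w
    unfolding psl_edge_iff_farey_edge[symmetric]
    by (auto simp: arcs_ends_def arc_to_ends_def farey_graph_def)
  then have arcs: "set (vwalk_arcs (map X [0..<Suc n])) \<subseteq> arcs_ends (with_proj (farey_graph d))
      \<longleftrightarrow> (\<forall>i<n. farey_edge (X i) (X (Suc i)))"
    using set_vwalk_arcs_map_upt[of X 0 n] by (simp add: image_subset_iff Ball_def del: upt_Suc)
  \<comment> \<open>The vertex condition of \<open>vwalk\<close> follows from the arc condition,
    given that the walk starts at infinity.\<close>
  have verts: "X k \<in> verts (with_proj (farey_graph d))"
    if "\<forall>i<n. farey_edge (X i) (X (Suc i))" "k \<le> n" for k
  proof (cases k)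
    case (Suc i)
    then have "farey_edge (X i) (X k)"
      using that by simp
    from farey_edge_target_in_verts[OF complex_subring_axioms this] show ?thesis
      by (simp add: farey_graph_def)
  qed (simp add: assms(2) farey_graph_def)
  show ?thesis
    unfolding vwalk_def arcs using verts by (auto simp del: upt_Suc)
qed

theorem theorem1:
  fixes d n :: nat and x :: complex and R :: "nat \<Rightarrow> csphere"
  assumes "d \<in> {1, 2, 3, 7, 11}"
    and "x \<in> Q_sqrt_neg d"
    and "n \<ge> 1"
    and "R n = Fin x"
  shows "(\<exists>a :: nat \<Rightarrow> complex. (\<forall>i<n. a i \<in> Z_omega d) \<and>
            (\<forall>k\<in>{1..n}. R k = cfrac_convergent a (k - 1)))
     \<longleftrightarrow> vwalk (Infty # map R [1..<Suc n]) (with_proj (farey_graph d))"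
proof -
  interpret complex_subring "Z_omega d"
    using complex_subring_Z_omega[OF assms(1)] .
  \<comment> \<open>Index 0 is set to the initial vertex, which makes the walk a single sequence
    indexed from 0.\<close>
  define X where "X = R(0 := Infty)"
  have X0: "X 0 = Infty"
    by (simp add: X_def)
  have "map X [0..<Suc n] = Infty # map X [1..<Suc n]"
    by (simp add: upt_conv_Cons X0 del: upt_Suc)
  also have "map X [1..<Suc n] = map R [1..<Suc n]"
    by (auto simp: X_def simp del: upt_Suc)
  finally have walk: "Infty # map R [1..<Suc n] = map X [0..<Suc n]" ..
  \<comment> \<open>The convergent with index \<open>k - 1\<close> has \<open>k\<close> quotients,
    and \<open>1 \<le> k\<close> makes their list nonempty.\<close>
  have "R k = cfrac_convergent a (k - 1) \<longleftrightarrow>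
      X k = moebius (cf_matrix (map a [0..<k])) Infty" if "1 \<le> k" for k a
    using that by (simp add: X_def cfrac_convergent_def cfrac_eval_eq_moebius del: upt_Suc)
  then have "(\<forall>k\<in>{1..n}. R k = cfrac_convergent a (k - 1)) \<longleftrightarrow>
      (\<forall>k\<in>{1..n}. X k = moebius (cf_matrix (map a [0..<k])) Infty)" for a
    by simp
  also have "\<dots> a \<longleftrightarrow> (\<forall>k\<le>n. X k = moebius (cf_matrix (map a [0..<k])) Infty)" for a
  proof -
    \<comment> \<open>At index 0 the condition holds automatically, so the range
      \<open>{1..n}\<close> extends to all \<open>k \<le> n\<close>.\<close>
    have "X 0 = moebius (cf_matrix (map a [0..<0])) Infty"
      by (simp add: X0)
    then show ?thesis
      by (metis atLeastAtMost_iff less_one not_le)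
  qed
  finally show ?thesis
    unfolding walk vwalk_farey_graph_iff[of d X, OF assms(1) X0]
      farey_path_iff_convergents[of X, OF X0]
    by simp
qed

end
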